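(* Let $m\ge 2$ and $k\ge 1$ be integers. Define polynomials $P_{k,j}(x)$ ($0\le j\le k$) and $Q_k(x)$ in $\mathbb{Z}[x]$ recursively by $P_{0,0}(x)=1$, $Q_0(x)=-1$, and for $k\ge 1$: \[ P_{k,0}(x)=x^{m^{k-1}-1}P_{k-1,0}(x),\qquad P_{k,k}(x)=-P_{k-1,k-1}(x),\qquad Q_k(x)=x^{m^{k-1}}Q_{k-1}(x), \] \[ P_{k,j}(x)=x^{m^{k-1}-m^{j}}P_{k-1,j}(x)-x^{m^{k-1}-m^{j-1}}P_{k-1,j-1}(x)\quad\text{for } j\in\{1,\ldots,k-1\}. \] Then the power series $A_m(k,x)$ satisfies \[ \sum_{j=0}^{k}P_{k,j}(x)A_m\big(k,x^{m^j}\big)+Q_k(x)=0. \]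
   Context: For integers $m\ge 2$, $k\ge 0$, $n\ge 0$, $a_m(k,n)$ denotes the number of partitions of $n$ into exactly $k$ parts, each a power of $m$, and $A_m(k,x):=\sum_{n=0}^{\infty}a_m(k,n)x^n$. *)

theory Defs
  imports
    "HOL-Library.Multiset"
    "HOL-Computational_Algebra.Polynomial_FPS"
begin

definition power_partitions :: "nat \<Rightarrow> nat \<Rightarrow> nat \<Rightarrow> nat multiset set" where
  "power_partitions m k n =
     {M. size M = k \<and> sum_mset M = n \<and> (\<forall>p\<in>#M. \<exists>i. p = m ^ i)}"

definition a_count :: "nat \<Rightarrow> nat \<Rightarrow> nat \<Rightarrow> nat" where
  "a_count m k n = card (power_partitions m k n)"

definition A_fps :: "nat \<Rightarrow> nat \<Rightarrow> int fps" where
  "A_fps m k = Abs_fps (\<lambda>n. int (a_count m k n))"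

(* P_poly m k j is meaningful only for j <= k and is set to 0 otherwise.
   For m >= 1 the truncated subtractions in the exponents are exact. *)
fun P_poly :: "nat \<Rightarrow> nat \<Rightarrow> nat \<Rightarrow> int poly" where
  "P_poly m 0 j = (if j = 0 then 1 else 0)"
| "P_poly m (Suc k) j =
     (if j = 0 then monom 1 (m ^ k - 1) * P_poly m k 0
      else if j \<le> k then
        monom 1 (m ^ k - m ^ j) * P_poly m k j - monom 1 (m ^ k - m ^ (j - 1)) * P_poly m k (j - 1)
      else if j = Suc k then - P_poly m k k
      else 0)"

fun Q_poly :: "nat \<Rightarrow> nat \<Rightarrow> int poly" where
  "Q_poly m 0 = -1"
| "Q_poly m (Suc k) = monom 1 (m ^ k) * Q_poly m k"

end

theory Submission
  imports Defs "HOL-Computational_Algebra.Formal_Laurent_Series"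
begin

text \<open>
  A partition into \<open>k + 1\<close> powers of \<open>m\<close> either contains the part \<open>1\<close>, which can be removed, or
  has all parts divisible by \<open>m\<close>, so that it can be divided by \<open>m\<close>. Hence
  \<open>A(k + 1, x) - A(k + 1, x^m) = x A(k, x)\<close>. The recursion for \<open>P\<close> is a summation by parts: it
  groups the terms of the sum for \<open>k + 1\<close> into multiples of these differences at \<open>x^(m^j)\<close>,
  which reduces that sum to \<open>x^(m^k)\<close> times the sum for \<open>k\<close>.
\<close>

lemma multisets_of_size_image:
  "multisets_of_size (f ` A) k = image_mset f ` multisets_of_size A k"
proof (intro equalityI subsetI)
  fix M assume M: "M \<in> multisets_of_size (f ` A) k"
  define N where "N = image_mset (inv_into A f) M"
  have "image_mset (\<lambda>y. f (inv_into A f y)) M = image_mset (\<lambda>y. y) M"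
    using M by (intro image_mset_cong) (auto simp: multisets_of_size_def intro: f_inv_into_f)
  then have "M = image_mset f N"
    by (simp add: N_def multiset.map_comp o_def)
  moreover have "N \<in> multisets_of_size A k"
    using M by (auto simp: N_def multisets_of_size_def intro: inv_into_into)
  ultimately show "M \<in> image_mset f ` multisets_of_size A k"
    by blast
qed (fastforce simp: multisets_of_size_def)

definition partitions_into :: "nat set \<Rightarrow> nat \<Rightarrow> nat \<Rightarrow> nat multiset set" where
  "partitions_into S k n = {M \<in> multisets_of_size S k. sum_mset M = n}"

lemma finite_partitions_into: "finite (partitions_into S k n)"
proof (rule finite_subset)
  have "set_mset M \<subseteq> {..n}" if "sum_mset M = n" for M :: "nat multiset"
    using that by (auto dest: multi_member_split)
  then show "partitions_into S k n \<subseteq> multisets_of_size {..n} k"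
    by (auto simp: partitions_into_def multisets_of_size_def)
qed auto

lemma partitions_into_insert_Suc:
  "partitions_into (insert c S) (Suc k) n =
    (if c \<le> n then add_mset c ` partitions_into (insert c S) k (n - c) else {}) \<union>
    partitions_into S (Suc k) n"
proof (intro equalityI subsetI)
  fix M assume M: "M \<in> partitions_into (insert c S) (Suc k) n"
  show "M \<in> (if c \<le> n then add_mset c ` partitions_into (insert c S) k (n - c) else {}) \<union>
    partitions_into S (Suc k) n"
  proof (cases "c \<in># M")
    case True
    then obtain N where "M = add_mset c N"
      by (auto dest: multi_member_split)
    with M show ?thesis
      by (auto simp: partitions_into_def multisets_of_size_def)
  next
    case False
    with M show ?thesis
      by (auto simp: partitions_into_def multisets_of_size_def)
  qed
qed (auto simp: partitions_into_def multisets_of_size_def split: if_splits)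

lemma partitions_into_image_mult:
  assumes "c > 0"
  shows "partitions_into ((*) c ` S) k n =
    (if c dvd n then image_mset ((*) c) ` partitions_into S k (n div c) else {})"
proof -
  have "sum_mset (image_mset ((*) c) N) = c * sum_mset N" for N :: "nat multiset"
    using sum_mset_distrib_left[of c "\<lambda>p. p" N] by simp
  then have "partitions_into ((*) c ` S) k n =
      image_mset ((*) c) ` {N \<in> multisets_of_size S k. c * sum_mset N = n}"
    by (auto simp: partitions_into_def multisets_of_size_image)
  also have "{N \<in> multisets_of_size S k. c * sum_mset N = n} =
      (if c dvd n then partitions_into S k (n div c) else {})"
    using assms by (auto simp: partitions_into_def)
  finally show ?thesis
    by simp
qed

definition partition_fps :: "nat set \<Rightarrow> nat \<Rightarrow> 'a::comm_semiring_1 fps" where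
  "partition_fps S k = Abs_fps (\<lambda>n. of_nat (card (partitions_into S k n)))"

lemma partition_fps_0: "partition_fps S 0 = 1"
proof (rule fps_ext)
  fix n
  have "partitions_into S 0 n = (if n = 0 then {{#}} else {})"
    by (auto simp: partitions_into_def)
  then show "partition_fps S 0 $ n = 1 $ n"
    by (simp add: partition_fps_def)
qed

lemma partition_fps_insert_Suc:
  assumes "c \<notin> S"
  shows "partition_fps (insert c S) (Suc k) =
    fps_X ^ c * partition_fps (insert c S) k + partition_fps S (Suc k)"
proof (rule fps_ext)
  fix n
  let ?with_c = "if c \<le> n then add_mset c ` partitions_into (insert c S) k (n - c) else {}"
  have "c \<notin># M" if "M \<in> partitions_into S (Suc k) n" for M
    using that assms by (auto simp: partitions_into_def multisets_of_size_def)
  then have "?with_c \<inter> partitions_into S (Suc k) n = {}"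
    by (fastforce split: if_splits)
  then have "card (partitions_into (insert c S) (Suc k) n) =
      card ?with_c + card (partitions_into S (Suc k) n)"
    unfolding partitions_into_insert_Suc by (intro card_Un_disjoint) (auto simp: finite_partitions_into)
  also have "card ?with_c = (if c \<le> n then card (partitions_into (insert c S) k (n - c)) else 0)"
    by (simp add: card_image inj_on_def)
  finally show "partition_fps (insert c S) (Suc k) $ n =
      (fps_X ^ c * partition_fps (insert c S) k + partition_fps S (Suc k)) $ n"
    by (simp add: partition_fps_def fps_X_power_mult_nth)
qed

lemma partition_fps_image_mult:
  assumes "c > 0"
  shows "partition_fps ((*) c ` S) k = partition_fps S k oo fps_X ^ c"
proof (rule fps_ext)
  fix n
  have "inj (image_mset ((*) c))"
    using assms by (intro multiset.inj_map) (simp add: inj_on_def)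
  then show "partition_fps ((*) c ` S) k $ n = (partition_fps S k oo fps_X ^ c) $ n"
    using assms
    by (simp add: partition_fps_def partitions_into_image_mult fps_nth_compose_X_power
        card_image inj_on_subset[OF _ subset_UNIV])
qed

lemma A_fps_eq_partition_fps: "A_fps m k = partition_fps (range ((^) m)) k"
proof -
  have "power_partitions m k n = partitions_into (range ((^) m)) k n" for n
    by (auto simp: power_partitions_def partitions_into_def multisets_of_size_def)
  then show ?thesis
    by (simp add: A_fps_def a_count_def partition_fps_def)
qed

lemma range_power_eq_insert:
  fixes a :: "'a::monoid_mult"
  shows "range ((^) a) = insert 1 ((*) a ` range ((^) a))"
proof -
  have "(UNIV :: nat set) = insert 0 (range Suc)"
    by (auto simp flip: greaterThan_0)
  then have "range ((^) a) = (^) a ` insert 0 (range Suc)"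
    by (rule arg_cong)
  also have "\<dots> = insert 1 ((*) a ` range ((^) a))"
    by (simp add: image_image)
  finally show ?thesis .
qed

lemma A_fps_Suc:
  assumes "m \<ge> 2"
  shows "A_fps m (Suc k) = fps_X * A_fps m k + (A_fps m (Suc k) oo fps_X ^ m)"
proof -
  let ?powers = "range ((^) m)"
  have "1 \<notin> (*) m ` ?powers"
    using assms by auto
  from partition_fps_insert_Suc[OF this, of k] show ?thesis
    using assms unfolding range_power_eq_insert[symmetric]
    by (simp add: A_fps_eq_partition_fps partition_fps_image_mult)
qed

lemma fps_compose_X_power_X_power:
  fixes f :: "'a::comm_semiring_1 fps"
  assumes "d > 0"
  shows "f oo fps_X ^ c oo fps_X ^ d = f oo fps_X ^ (c * d)"
  using assms by (intro fps_ext)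
    (auto simp: fps_nth_compose_X_power dvd_div_iff_mult div_mult2_eq mult.commute)

lemma A_fps_Suc_compose_X_power:
  assumes "m \<ge> 2" and "d > 0"
  shows "(A_fps m (Suc k) oo fps_X ^ d) - (A_fps m (Suc k) oo fps_X ^ (m * d)) =
    fps_X ^ d * (A_fps m k oo fps_X ^ d)"
proof -
  have "(fps_X ^ d :: int fps) $ 0 = 0"
    using \<open>d > 0\<close> by simp
  moreover have "A_fps m (Suc k) oo fps_X ^ d =
      fps_X * A_fps m k + (A_fps m (Suc k) oo fps_X ^ m) oo fps_X ^ d"
    by (subst A_fps_Suc[OF \<open>m \<ge> 2\<close>]) (rule refl)
  ultimately show ?thesis
    using \<open>d > 0\<close>
    by (simp add: fps_compose_add_distrib fps_compose_mult_distrib fps_X_fps_compose_startby0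
        fps_compose_X_power_X_power)
qed

lemma P_poly_eq_0: "j > k \<Longrightarrow> P_poly m k j = 0"
  by (cases k) auto

definition P_weight :: "nat \<Rightarrow> nat \<Rightarrow> nat \<Rightarrow> int poly" where
  "P_weight m k j = monom 1 (m ^ k - m ^ j) * P_poly m k j"

lemma P_poly_Suc_0: "P_poly m (Suc k) 0 = P_weight m k 0"
  by (simp add: P_weight_def)

lemma P_poly_Suc_Suc: "P_poly m (Suc k) (Suc j) = P_weight m k (Suc j) - P_weight m k j"
  by (auto simp: P_weight_def P_poly_eq_0)

lemma sum_by_parts:
  fixes a b :: "nat \<Rightarrow> 'a::ring"
  shows "a 0 * b 0 + (\<Sum>j=0..n. (a (Suc j) - a j) * b (Suc j)) =
    (\<Sum>j=0..n. a j * (b j - b (Suc j))) + a (Suc n) * b (Suc n)"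
  by (induction n) (simp_all add: algebra_simps)

lemma sum_P_poly_Suc:
  fixes b :: "nat \<Rightarrow> int fps"
  shows "(\<Sum>j=0..Suc k. fps_of_poly (P_poly m (Suc k) j) * b j) =
    (\<Sum>j=0..k. fps_of_poly (P_weight m k j) * (b j - b (Suc j)))"
proof -
  let ?a = "\<lambda>j. fps_of_poly (P_weight m k j)"
  have "(\<Sum>j=0..Suc k. fps_of_poly (P_poly m (Suc k) j) * b j) =
      ?a 0 * b 0 + (\<Sum>j=0..k. (?a (Suc j) - ?a j) * b (Suc j))"
    by (simp add: sum.atLeast0_atMost_Suc_shift P_poly_Suc_0 P_poly_Suc_Suc fps_of_poly_diff
        del: P_poly.simps sum.cl_ivl_Suc)
  also have "\<dots> = (\<Sum>j=0..k. ?a j * (b j - b (Suc j))) + ?a (Suc k) * b (Suc k)"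
    by (rule sum_by_parts)
  also have "?a (Suc k) = 0"
    by (simp add: P_weight_def P_poly_eq_0)
  finally show ?thesis
    by simp
qed

lemma fps_of_poly_P_weight_mult_fps_X_power:
  assumes "m > 0" and "j \<le> k"
  shows "fps_of_poly (P_weight m k j) * fps_X ^ (m ^ j) = fps_X ^ (m ^ k) * fps_of_poly (P_poly m k j)"
proof -
  have "m ^ j \<le> m ^ k"
    using assms by (intro power_increasing) auto
  then have "fps_X ^ (m ^ k) = (fps_X ^ (m ^ k - m ^ j) * fps_X ^ (m ^ j) :: int fps)"
    by (simp flip: power_add)
  then show ?thesis
    by (simp add: P_weight_def fps_of_poly_mult fps_of_poly_monom mult_ac)
qed

lemma sum_P_poly_A_fps_Suc:
  assumes "m \<ge> 2"
  shows "(\<Sum>j=0..Suc k. fps_of_poly (P_poly m (Suc k) j) * (A_fps m (Suc k) oo fps_X ^ (m ^ j))) =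
    fps_X ^ (m ^ k) * (\<Sum>j=0..k. fps_of_poly (P_poly m k j) * (A_fps m k oo fps_X ^ (m ^ j)))"
proof -
  let ?A = "\<lambda>k j. A_fps m k oo fps_X ^ (m ^ j)"
  have "(\<Sum>j=0..Suc k. fps_of_poly (P_poly m (Suc k) j) * ?A (Suc k) j) =
      (\<Sum>j=0..k. fps_of_poly (P_weight m k j) * (?A (Suc k) j - ?A (Suc k) (Suc j)))"
    by (rule sum_P_poly_Suc)
  also have "\<dots> = (\<Sum>j=0..k. fps_of_poly (P_weight m k j) * fps_X ^ (m ^ j) * ?A k j)"
    using assms by (simp add: A_fps_Suc_compose_X_power mult.assoc)
  also have "\<dots> = (\<Sum>j=0..k. fps_X ^ (m ^ k) * (fps_of_poly (P_poly m k j) * ?A k j))"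
    using assms by (intro sum.cong refl) (simp add: fps_of_poly_P_weight_mult_fps_X_power mult.assoc)
  finally show ?thesis
    by (simp only: sum_distrib_left)
qed

theorem theorem6p5:
  fixes m k :: nat
  assumes "m \<ge> 2" and "k \<ge> 1"
  shows "(\<Sum>j=0..k. fps_of_poly (P_poly m k j) * (A_fps m k oo fps_X ^ (m ^ j))) + fps_of_poly (Q_poly m k) = 0"
    (is "?S k + fps_of_poly (Q_poly m k) = 0")
proof (induction k)
  case 0
  show ?case
    by (simp add: A_fps_eq_partition_fps partition_fps_0)
next
  case (Suc k)
  have "?S (Suc k) + fps_of_poly (Q_poly m (Suc k)) =
      fps_X ^ (m ^ k) * (?S k + fps_of_poly (Q_poly m k))"
    unfolding sum_P_poly_A_fps_Suc[OF \<open>m \<ge> 2\<close>]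
    by (simp add: fps_of_poly_mult fps_of_poly_monom distrib_left)
  then show ?case
    by (simp add: Suc.IH)
qed

end
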